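(* Let $X$ be a real uniformly convex Banach space, let $K$ be a nonempty closed subset of $X$, let $x\in X\setminus K$, and suppose that the distance function $d_K$ is Fréchet differentiable at $x$. Then $K$ is a Čebyšev set in $X$.
   Context: For a nonempty subset $K$ of a real normed linear space $X$ with topological dual $X^*$, the distance function is $d_K:X\to\mathbb{R}$, $d_K(z)=\inf\{\|y-z\| : y\in K\}$. The set of best approximations to $z$ from $K$ is $P_K(z)=\{y\in K : \|y-z\|=d_K(z)\}$. The set $K$ is called Čebyšev if $P_K(z)$ is a singleton for every $z\in X\setminus K$. A function $f:X\to\mathbb{R}$ is Fréchet differentiable at $x$ if there is $A\in X^*$ such that $A(y)=\lim_{t\to0}\frac{f(x+ty)-f(x)}{t}$, the limit existing uniformly for $y$ in the unit sphere $\{y\in X:\|y\|=1\}$. The space $X$ is called uniformly convex if, for sequences $(x_n)_{n=1}^\infty,(y_n)_{n=1}^\infty$ in $X$ with $\lim_{n\to\infty}\left(2\|x_n\|^2+2\|y_n\|^2-\|x_n+y_n\|^2\right)=0$, one has $\lim_{n\to\infty}\|x_n-y_n\|=0$.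
   Formalization: The distance function is assumed Fréchet differentiable at every x in X∖K, not just at one given x; with a single x the claim fails (X = ℝ, K = {−1, 1}, x = 2). *)

theory Defs
  imports "HOL-Analysis.Analysis"
begin

definition best_approximations :: "'a::real_normed_vector set \<Rightarrow> 'a \<Rightarrow> 'a set" where
  "best_approximations K z = {y \<in> K. norm (y - z) = infdist z K}"

definition chebyshev_set :: "'a::real_normed_vector set \<Rightarrow> bool" where
  "chebyshev_set K \<longleftrightarrow> (\<forall>z \<in> UNIV - K. is_singleton (best_approximations K z))"

(* A property of the norm on the whole type, so the predicate takes the type itself. *)
definition uniformly_convex :: "'a::real_normed_vector itself \<Rightarrow> bool" where
  "uniformly_convex _ \<longleftrightarrow>
    (\<forall>(x :: nat \<Rightarrow> 'a) y.
      (\<lambda>n. 2 * (norm (x n))\<^sup>2 + 2 * (norm (y n))\<^sup>2 - (norm (x n + y n))\<^sup>2) \<longlonglongrightarrow> 0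
      \<longrightarrow> (\<lambda>n. norm (x n - y n)) \<longlonglongrightarrow> 0)"

(* The distance function d_K is the library's infdist, which is set to 0 on the empty set
   but agrees with the usual infimum of norms otherwise. *)
lemma infdist_eq_INF_norm:
  fixes K :: "'a::real_normed_vector set"
  assumes "K \<noteq> {}"
  shows "infdist z K = (INF y\<in>K. norm (y - z))"
  using assms by (simp add: infdist_def dist_norm norm_minus_commute)

(* The library's differentiability is Frechet differentiability: a bounded linear derivative
   approximating the increment up to o(norm h). *)
lemma differentiable_at_iff_frechet:
  fixes f :: "'a::real_normed_vector \<Rightarrow> real"
  shows "f differentiable (at x) \<longleftrightarrow>
    (\<exists>A. bounded_linear A \<and>
      ((\<lambda>h. \<bar>f (x + h) - f x - A h\<bar> / norm h) \<longlongrightarrow> 0) (at 0))"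
  by (simp add: differentiable_def has_derivative_at)

end

theory Submission imports Defs begin

text \<open>
  Let \<open>A\<close> be the derivative of the distance function at \<open>x\<close>, outside \<open>K\<close>. Moving from \<open>x\<close> towards a
  nearly best approximation \<open>y\<close> decreases the distance at almost unit rate, so \<open>A (y n - x)\<close> tends
  to \<open>- infdist x K\<close> along every minimizing sequence \<open>y\<close>. As the distance function is
  1-Lipschitz, \<open>A\<close> has norm at most 1, which forces the norm of \<open>(y n - x) + (z n - x)\<close> to tend to
  \<open>2 * infdist x K\<close> for any two minimizing sequences \<open>y\<close>, \<open>z\<close>. Uniform convexity then gives
  \<open>y n - z n \<longrightarrow> 0\<close>, whence minimizing sequences are Cauchy and best approximations are unique.
\<close>

text \<open>Every difference quotient of \<open>f\<close> at \<open>x\<close> in direction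
  \<open>w\<close> is at most \<open>norm w\<close> in absolute value, and \<open>A w\<close> is
  their limit. One sufficiently small step \<open>t\<close> already gives the bound up to
  \<open>e\<close>.\<close>

lemma lipschitz_derivative_bound:
  fixes f :: "'a::real_normed_vector \<Rightarrow> real"
  assumes deriv: "(f has_derivative A) (at x)"
    and lip: "\<And>y. \<bar>f y - f x\<bar> \<le> norm (y - x)"
  shows "\<bar>A w\<bar> \<le> norm w"
proof (rule field_le_epsilon)
  fix e :: real assume "e > 0"
  interpret A: bounded_linear A
    using deriv by (rule has_derivative_bounded_linear)
  \<comment> \<open>Chosen so that the error \<open>c * norm w\<close> stays below \<open>e\<close>;
    the summand 1 keeps the denominator positive when \<open>w = 0\<close>.\<close>
  define c where "c = e / (norm w + 1)"
  have "c > 0"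
    using \<open>e > 0\<close> by (simp add: c_def add_nonneg_pos)
  then obtain \<delta> where "\<delta> > 0"
    and \<delta>: "\<And>y. norm (y - x) < \<delta> \<Longrightarrow> norm (f y - f x - A (y - x)) \<le> c * norm (y - x)"
    using deriv unfolding has_derivative_at_alt by blast
  define t where "t = \<delta> / (norm w + 1)"
  have "t > 0"
    using \<open>\<delta> > 0\<close> by (simp add: t_def add_nonneg_pos)
  have "t * norm w < \<delta>"
    using \<open>\<delta> > 0\<close> by (simp add: t_def divide_simps add_nonneg_pos)
  then have "\<bar>f (x + t *\<^sub>R w) - f x - t * A w\<bar> \<le> c * (t * norm w)"
    using \<delta>[of "x + t *\<^sub>R w"] \<open>t > 0\<close> by (simp add: A.scaleR)
  moreover have "\<bar>f (x + t *\<^sub>R w) - f x\<bar> \<le> t * norm w"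
    using lip[of "x + t *\<^sub>R w"] \<open>t > 0\<close> by simp
  ultimately have "\<bar>t * A w\<bar> \<le> t * norm w + c * (t * norm w)"
    by linarith
  then have "t * \<bar>A w\<bar> \<le> t * (norm w + c * norm w)"
    using \<open>t > 0\<close> by (simp add: abs_mult algebra_simps)
  then have "\<bar>A w\<bar> \<le> norm w + c * norm w"
    using \<open>t > 0\<close> by simp
  moreover have "c * norm w \<le> e"
    using \<open>e > 0\<close> by (simp add: c_def divide_simps add_nonneg_pos)
  ultimately show "\<bar>A w\<bar> \<le> norm w + e"
    by linarith
qed

lemma infdist_derivative_bound:
  assumes "((\<lambda>z. infdist z K) has_derivative A) (at x)"
  shows "\<bar>A w\<bar> \<le> norm w"
  using assms
  by (rule lipschitz_derivative_bound) (metis dist_norm infdist_triangle_abs)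

text \<open>The lower bound comes from \<open>A\<close> having norm at most 1. For the upper bound,
  the step length \<open>t\<close> is fixed before \<open>n\<close> grows, so that the excess of
  \<open>norm (y n - x)\<close> over the distance vanishes even after division by
  \<open>t\<close>.\<close>

lemma infdist_derivative_minimizing_sequence:
  fixes K :: "'a::real_normed_vector set"
  assumes deriv: "((\<lambda>z. infdist z K) has_derivative A) (at x)"
    and pos: "infdist x K > 0"
    and K: "\<And>n::nat. y n \<in> K"
    and lim: "(\<lambda>n. norm (y n - x)) \<longlonglongrightarrow> infdist x K"
  shows "(\<lambda>n. A (y n - x)) \<longlonglongrightarrow> - infdist x K"
proof (rule order_tendstoI)
  fix a assume a: "a < - infdist x K"
  have "(\<lambda>n. - norm (y n - x)) \<longlonglongrightarrow> - infdist x K"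
    using lim by (rule tendsto_minus)
  then have "\<forall>\<^sub>F n in sequentially. a < - norm (y n - x)"
    using a by (rule order_tendstoD)
  then show "\<forall>\<^sub>F n in sequentially. a < A (y n - x)"
  proof eventually_elim
    case (elim n)
    then show ?case
      using infdist_derivative_bound[OF deriv, of "y n - x"] by linarith
  qed
next
  fix a assume a: "a > - infdist x K"
  let ?d = "infdist x K"
  interpret A: bounded_linear A
    using deriv by (rule has_derivative_bounded_linear)
  \<comment> \<open>With this choice \<open>(e - 1) * ?d\<close> is the midpoint of
    \<open>- ?d\<close> and \<open>a\<close>, hence below \<open>a\<close>.\<close>
  define e where "e = (a + ?d) / (2 * ?d)"
  have "e > 0"
    using a pos by (simp add: e_def)
  then obtain \<delta> where "\<delta> > 0"
    and \<delta>: "\<And>z. norm (z - x) < \<delta> \<Longrightarrow>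
      norm (infdist z K - ?d - A (z - x)) \<le> e * norm (z - x)"
    using deriv unfolding has_derivative_at_alt by blast
  \<comment> \<open>Eventually \<open>norm (y n - x) < ?d + 1\<close>, so a single \<open>t\<close>
    keeps \<open>x + t *\<^sub>R (y n - x)\<close> within \<open>\<delta>\<close> of
    \<open>x\<close> for all large \<open>n\<close>; \<open>t \<le> 1\<close> keeps that point on
    the segment from \<open>x\<close> to \<open>y n\<close>.\<close>
  define t where "t = min 1 (\<delta> / (?d + 1))"
  have t: "0 < t" "t \<le> 1"
    using \<open>\<delta> > 0\<close> pos by (auto simp: t_def)
  have "t * (?d + 1) \<le> \<delta> / (?d + 1) * (?d + 1)"
    using pos by (intro mult_right_mono) (auto simp: t_def)
  then have t\<delta>: "t * (?d + 1) \<le> \<delta>"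
    using pos by simp
  \<comment> \<open>The bound on \<open>A (y n - x)\<close> obtained by combining the derivative
    estimate with the distance from the point on the segment to \<open>y n\<close>, and dividing by
    \<open>t\<close>.\<close>
  define b where "b n = (e - 1) * norm (y n - x) + (norm (y n - x) - ?d) / t" for n
  have "b \<longlonglongrightarrow> (e - 1) * ?d + (?d - ?d) / t"
    unfolding b_def using t by (intro tendsto_intros lim) auto
  moreover have "(e - 1) * ?d + (?d - ?d) / t < a"
  proof -
    have "e * ?d = (a + ?d) / 2"
      using pos by (simp add: e_def)
    then show ?thesis
      using a by (simp add: left_diff_distrib)
  qed
  ultimately have "\<forall>\<^sub>F n in sequentially. b n < a"
    by (rule order_tendstoD)
  moreover have "\<forall>\<^sub>F n in sequentially. norm (y n - x) < ?d + 1"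
    using lim by (rule order_tendstoD) simp
  ultimately show "\<forall>\<^sub>F n in sequentially. A (y n - x) < a"
  proof eventually_elim
    case (elim n)
    let ?u = "y n - x"
    have "t * norm ?u < t * (?d + 1)"
      using elim t by simp
    with t\<delta> have "t * norm ?u < \<delta>"
      by linarith
    then have "\<bar>infdist (x + t *\<^sub>R ?u) K - ?d - t * A ?u\<bar> \<le> e * (t * norm ?u)"
      using \<delta>[of "x + t *\<^sub>R ?u"] t by (simp add: A.scaleR)
    moreover have "infdist (x + t *\<^sub>R ?u) K \<le> (1 - t) * norm ?u"
    proof -
      have "infdist (x + t *\<^sub>R ?u) K \<le> dist (x + t *\<^sub>R ?u) (y n)"
        using K by (rule infdist_le)
      also have "\<dots> = norm ((1 - t) *\<^sub>R ?u)"
        by (simp add: dist_norm norm_minus_commute algebra_simps)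
      finally show ?thesis
        using t by simp
    qed
    ultimately have "t * A ?u \<le> e * (t * norm ?u) + (1 - t) * norm ?u - ?d"
      by linarith
    also have "\<dots> = t * b n"
      using t by (simp add: b_def field_simps)
    finally have "A ?u \<le> b n"
      using t by simp
    then show ?case
      using elim by linarith
  qed
qed

text \<open>The norm of the sum is squeezed between minus the value of \<open>A\<close> at the sum
  and the sum of the norms, both tending to \<open>2 * infdist x K\<close>. The expression in the
  definition of uniform convexity therefore tends to 0.\<close>

lemma minimizing_sequences_asymptotic:
  fixes K :: "'a::real_normed_vector set"
  assumes uc: "uniformly_convex TYPE('a)"
    and deriv: "((\<lambda>z. infdist z K) has_derivative A) (at x)"
    and pos: "infdist x K > 0"
    and yK: "\<And>n::nat. y n \<in> K" and y: "(\<lambda>n. norm (y n - x)) \<longlonglongrightarrow> infdist x K"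
    and zK: "\<And>n::nat. z n \<in> K" and z: "(\<lambda>n. norm (z n - x)) \<longlonglongrightarrow> infdist x K"
  shows "(\<lambda>n. norm (y n - z n)) \<longlonglongrightarrow> 0"
proof -
  let ?d = "infdist x K"
  let ?s = "\<lambda>n. norm ((y n - x) + (z n - x))"
  interpret A: bounded_linear A
    using deriv by (rule has_derivative_bounded_linear)
  have s: "?s \<longlonglongrightarrow> ?d + ?d"
  proof (rule tendsto_sandwich)
    have "(\<lambda>n. - (A (y n - x) + A (z n - x))) \<longlonglongrightarrow> - (- ?d + - ?d)"
      by (intro tendsto_minus tendsto_add infdist_derivative_minimizing_sequence
          deriv pos yK y zK z)
    then show "(\<lambda>n. - (A (y n - x) + A (z n - x))) \<longlonglongrightarrow> ?d + ?d"
      by simp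
    show "(\<lambda>n. norm (y n - x) + norm (z n - x)) \<longlonglongrightarrow> ?d + ?d"
      by (intro tendsto_add y z)
    show "\<forall>\<^sub>F n in sequentially. - (A (y n - x) + A (z n - x)) \<le> ?s n"
    proof (rule always_eventually, rule allI)
      fix n
      show "- (A (y n - x) + A (z n - x)) \<le> ?s n"
        using infdist_derivative_bound[OF deriv, of "(y n - x) + (z n - x)"]
        unfolding A.add by linarith
    qed
    show "\<forall>\<^sub>F n in sequentially. ?s n \<le> norm (y n - x) + norm (z n - x)"
      by (intro always_eventually allI norm_triangle_ineq)
  qed
  have "(\<lambda>n. 2 * (norm (y n - x))\<^sup>2 + 2 * (norm (z n - x))\<^sup>2 - (?s n)\<^sup>2)
      \<longlonglongrightarrow> 2 * ?d\<^sup>2 + 2 * ?d\<^sup>2 - (?d + ?d)\<^sup>2"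
    by (intro tendsto_intros y z s)
  also have "2 * ?d\<^sup>2 + 2 * ?d\<^sup>2 - (?d + ?d)\<^sup>2 = 0"
    by (simp add: power2_eq_square algebra_simps)
  finally have "(\<lambda>n. norm ((y n - x) - (z n - x))) \<longlonglongrightarrow> 0"
    using uc[unfolded uniformly_convex_def, rule_format, of "\<lambda>n. y n - x" "\<lambda>n. z n - x"] by blast
  then show ?thesis
    by simp
qed

lemma minimizing_sequence_exists:
  fixes K :: "'a::real_normed_vector set"
  assumes "K \<noteq> {}"
  obtains y where "\<And>n::nat. y n \<in> K" "(\<lambda>n. norm (y n - x)) \<longlonglongrightarrow> infdist x K"
proof -
  have "\<exists>y\<in>K. dist x y < infdist x K + inverse (real (Suc n))" for n
    using assms cInf_lessD[of "dist x ` K" "infdist x K + inverse (real (Suc n))"]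
    by (auto simp: infdist_def)
  then obtain y where K: "\<And>n. y n \<in> K"
    and less: "\<And>n. dist x (y n) < infdist x K + inverse (real (Suc n))"
    by metis
  have "(\<lambda>n. norm (y n - x)) \<longlonglongrightarrow> infdist x K"
  proof (rule tendsto_sandwich)
    show "\<forall>\<^sub>F n in sequentially. infdist x K \<le> norm (y n - x)"
      using infdist_le[OF K, of x] by (auto simp: dist_norm norm_minus_commute)
    show "\<forall>\<^sub>F n in sequentially. norm (y n - x) \<le> infdist x K + inverse (real (Suc n))"
      using less by (intro always_eventually allI) (simp add: dist_norm norm_minus_commute less_imp_le)
    show "(\<lambda>n. infdist x K + inverse (real (Suc n))) \<longlonglongrightarrow> infdist x K"
      using tendsto_add[OF tendsto_const LIMSEQ_inverse_real_of_nat] by simp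
  qed simp
  with K that show thesis
    by blast
qed

lemma best_approximations_is_singleton:
  fixes K :: "'a::banach set"
  assumes uc: "uniformly_convex TYPE('a)"
    and K: "K \<noteq> {}" "closed K" and x: "x \<notin> K"
    and diff: "(\<lambda>z. infdist z K) differentiable (at x)"
  shows "is_singleton (best_approximations K x)"
proof -
  let ?d = "infdist x K"
  obtain A where deriv: "((\<lambda>z. infdist z K) has_derivative A) (at x)"
    using diff by (auto simp: differentiable_def)
  have pos: "?d > 0"
    using K x by (simp add: infdist_pos_not_in_closed)
  note asymptotic = minimizing_sequences_asymptotic[OF uc deriv pos]
  obtain y where yK: "\<And>n::nat. y n \<in> K" and y: "(\<lambda>n. norm (y n - x)) \<longlonglongrightarrow> ?d"
    using minimizing_sequence_exists[OF K(1)] by metis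
  have "Cauchy y"
  proof (rule ccontr)
    assume "\<not> Cauchy y"
    then obtain e where "e > 0" and e: "\<And>N. \<exists>m\<ge>N. \<exists>n\<ge>N. e \<le> norm (y m - y n)"
      unfolding Cauchy_def dist_norm not_less not_all not_ex not_imp by blast
    \<comment> \<open>The index sequences need not be monotone: \<open>m N \<ge> N\<close> and
      \<open>n N \<ge> N\<close> already make \<open>y\<close> along each of them minimizing, so the
      gap \<open>e\<close> contradicts asymptotic equality.\<close>
    obtain m n where mn: "\<And>N. m N \<ge> N" "\<And>N. n N \<ge> N" "\<And>N. e \<le> norm (y (m N) - y (n N))"
      using e by metis
    have "filterlim m at_top sequentially" "filterlim n at_top sequentially"
      using mn by (auto intro: filterlim_at_top_mono[OF filterlim_ident])
    then have "(\<lambda>N. norm (y (m N) - x)) \<longlonglongrightarrow> ?d" "(\<lambda>N. norm (y (n N) - x)) \<longlonglongrightarrow> ?d"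
      using filterlim_compose[OF y] by blast+
    then have "(\<lambda>N. norm (y (m N) - y (n N))) \<longlonglongrightarrow> 0"
      by (intro asymptotic yK)
    then have "e \<le> 0"
      using mn(3) by (intro LIMSEQ_le_const) auto
    with \<open>e > 0\<close> show False
      by simp
  qed
  then obtain p where p: "y \<longlonglongrightarrow> p"
    by (auto simp: Cauchy_convergent_iff convergent_def)
  have "p \<in> K"
    using K(2) yK p by (rule closed_sequentially)
  moreover have "norm (p - x) = ?d"
    using tendsto_norm[OF tendsto_diff[OF p tendsto_const]] y by (rule LIMSEQ_unique)
  moreover have "q = p" if "q \<in> K" "norm (q - x) = ?d" for q
  proof -
    \<comment> \<open>Two best approximations, viewed as constant sequences, are both
      minimizing.\<close>
    have "(\<lambda>n::nat. norm (q - p)) \<longlonglongrightarrow> 0"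
      using that \<open>p \<in> K\<close> \<open>norm (p - x) = ?d\<close> by (intro asymptotic) auto
    then show ?thesis
      by (simp add: LIMSEQ_const_iff)
  qed
  ultimately have "best_approximations K x = {p}"
    unfolding best_approximations_def by blast
  then show ?thesis
    by simp
qed

theorem corollary8:
  fixes K :: "'a::banach set"
  assumes "uniformly_convex TYPE('a)"
    and "K \<noteq> {}" and "closed K"
    and "\<And>x. x \<in> UNIV - K \<Longrightarrow> (\<lambda>z. infdist z K) differentiable (at x)"
  shows "chebyshev_set K"
  using assms best_approximations_is_singleton unfolding chebyshev_set_def by blast

end
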